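(* Let $N=\frac{-1+\sqrt{2}}{2}$ and let $r$ be an odd positive integer. Choosing at each step the smallest allowed positive integer in the following procedure — $a_r$ the smallest integer with $a_r\ge 1+\lfloor N+1\rfloor$, $s_r=1-\frac{N+1}{a_r}$, and for $i=r-1,\ldots,1$: if $i$ is odd, $a_i=1+\left\lfloor\frac{N+1}{1-1/s_{i+1}}\right\rfloor$ and $s_i=f\!\left(s_{i+1},1-\frac{N+1}{a_i}\right)$; if $i$ is even, $a_i=1+\left\lfloor\frac{N}{s_{i+1}}\right\rfloor$ and $s_i=g\!\left(s_{i+1},-\frac{N}{a_i}\right)$ — yields $a_r=2$ and $a_1=\cdots=a_{r-1}=1$, and $T_G(1,\ldots,1,2)$ is $(0,N]$-eigenvalue free. Consequently, no threshold graph $T_G(a_1,\ldots,a_r)$ with $r$ odd, $a_r\ge 2$ and $a_i\ge 1$ for $1\le i\le r-1$ has an eigenvalue in the interval $(0,N]$.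
   Context: All graphs are finite, simple and undirected; eigenvalues are those of the adjacency matrix. A graph is $I$-eigenvalue free if it has no eigenvalue in the interval $I$. For an integer $r\ge 1$ and positive integers $a_1,\ldots,a_r$ with $a_r\ge 2$, the threshold graph $T_G(a_1,\ldots,a_r)$ is defined as follows: start with $G_r=K_{a_r}$ if $r$ is odd and $G_r=\overline{K_{a_r}}$ if $r$ is even; for $i=r-1,\ldots,1$, obtain $G_i$ from $G_{i+1}$ by adding $a_i$ new vertices adjacent to each other and to all vertices of $G_{i+1}$ if $i$ is odd, and $a_i$ new isolated vertices if $i$ is even; then $T_G(a_1,\ldots,a_r)=G_1$. Here $f(X,Y)=\frac{XY-1}{X+Y-2}$ and $g(X,Y)=\frac{XY}{X+Y}$. *)

theory Defs
  imports
    Complex_Main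
    "Graph_Theory.Pair_Digraph"
    "Jordan_Normal_Form.Char_Poly"
begin

text \<open>
  A finite simple undirected graph is a symmetric loop-free finite digraph, i.e. a
  \<open>pair_graph\<close>; an edge \<open>uv\<close> is the pair of arcs \<open>(u,v)\<close>, \<open>(v,u)\<close>.
\<close>

definition complete_graph :: "nat \<Rightarrow> nat pair_pre_digraph" where
  "complete_graph k = \<lparr> pverts = {..<k}, parcs = {(u, v). u < k \<and> v < k \<and> u \<noteq> v} \<rparr>"

definition empty_graph :: "nat \<Rightarrow> nat pair_pre_digraph" where
  "empty_graph k = \<lparr> pverts = {..<k}, parcs = {} \<rparr>"

text \<open>The first \<open>k\<close> natural numbers beyond all vertices of the graph.\<close>

definition new_verts :: "nat \<Rightarrow> nat pair_pre_digraph \<Rightarrow> nat set" where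
  "new_verts k G = (let n = (LEAST n. \<forall>v \<in> pverts G. v < n) in {n..<n + k})"

definition add_dominating :: "nat \<Rightarrow> nat pair_pre_digraph \<Rightarrow> nat pair_pre_digraph" where
  "add_dominating k G =
    (let W = new_verts k G in
      \<lparr> pverts = pverts G \<union> W,
        parcs = parcs G \<union> {(u, v). u \<in> W \<and> v \<in> W \<and> u \<noteq> v}
                  \<union> W \<times> pverts G \<union> pverts G \<times> W \<rparr>)"

definition add_isolated :: "nat \<Rightarrow> nat pair_pre_digraph \<Rightarrow> nat pair_pre_digraph" where
  "add_isolated k G = \<lparr> pverts = pverts G \<union> new_verts k G, parcs = parcs G \<rparr>"

text \<open>
  \<open>threshold_stage r a i\<close> is \<open>G\<^sub>i\<close>, for \<open>1 \<le> i \<le> r\<close>;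
  the parameters \<open>a\<^sub>1, \<dots>, a\<^sub>r\<close> are \<open>a 1, \<dots>, a r\<close>, other values of \<open>a\<close> are irrelevant.
\<close>

function threshold_stage :: "nat \<Rightarrow> (nat \<Rightarrow> nat) \<Rightarrow> nat \<Rightarrow> nat pair_pre_digraph" where
  "threshold_stage r a i =
    (if r \<le> i then (if odd r then complete_graph (a r) else empty_graph (a r))
     else if odd i then add_dominating (a i) (threshold_stage r a (i + 1))
     else add_isolated (a i) (threshold_stage r a (i + 1)))"
  by auto
termination by (relation "measure (\<lambda>(r, a, i). r - i)") auto

declare threshold_stage.simps [simp del]

definition threshold_graph :: "nat \<Rightarrow> (nat \<Rightarrow> nat) \<Rightarrow> nat pair_pre_digraph" where
  "threshold_graph r a = threshold_stage r a 1"

definition adjacency_matrix :: "'v::linorder pair_pre_digraph \<Rightarrow> real mat" where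
  "adjacency_matrix G =
    (let vs = sorted_list_of_set (pverts G)
     in mat (length vs) (length vs)
          (\<lambda>(i, j). if (vs ! i, vs ! j) \<in> parcs G then 1 else 0))"

definition eigenvalue_free :: "real set \<Rightarrow> 'v::linorder pair_pre_digraph \<Rightarrow> bool" where
  "eigenvalue_free I G \<longleftrightarrow> (\<forall>x \<in> I. \<not> eigenvalue (adjacency_matrix G) x)"

definition f_step :: "real \<Rightarrow> real \<Rightarrow> real" where
  "f_step X Y = (X * Y - 1) / (X + Y - 2)"

definition g_step :: "real \<Rightarrow> real \<Rightarrow> real" where
  "g_step X Y = X * Y / (X + Y)"

text \<open>
  \<open>greedy_run N r a s\<close>: the numbers \<open>a r, \<dots>, a 1\<close> and \<open>s r, \<dots>, s 1\<close> are produced by the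
  procedure that picks the smallest allowed integer at each step. All quotients that the
  procedure evaluates are required to have nonzero denominators, since division by zero
  would otherwise silently yield 0.
\<close>

definition greedy_run :: "real \<Rightarrow> nat \<Rightarrow> (nat \<Rightarrow> nat) \<Rightarrow> (nat \<Rightarrow> real) \<Rightarrow> bool" where
  "greedy_run N r a s \<longleftrightarrow>
    (\<forall>i \<in> {1..r}. 0 < a i) \<and>
    int (a r) = (LEAST m::int. 1 + \<lfloor>N + 1\<rfloor> \<le> m) \<and>
    s r = 1 - (N + 1) / real (a r) \<and>
    (\<forall>i \<in> {1..<r}. odd i \<longrightarrow>
      s (i + 1) \<noteq> 0 \<and> 1 - 1 / s (i + 1) \<noteq> 0 \<and>
      int (a i) = 1 + \<lfloor>(N + 1) / (1 - 1 / s (i + 1))\<rfloor> \<and>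
      s (i + 1) + (1 - (N + 1) / real (a i)) - 2 \<noteq> 0 \<and>
      s i = f_step (s (i + 1)) (1 - (N + 1) / real (a i))) \<and>
    (\<forall>i \<in> {1..<r}. even i \<longrightarrow>
      s (i + 1) \<noteq> 0 \<and>
      int (a i) = 1 + \<lfloor>N / s (i + 1)\<rfloor> \<and>
      s (i + 1) + - (N / real (a i)) \<noteq> 0 \<and>
      s i = g_step (s (i + 1)) (- (N / real (a i))))"

lemma threshold_graph_pair_graph: "pair_graph (threshold_graph r a)"
proof -
  have complete: "pair_graph (complete_graph k)" for k
  proof -
    have "finite {(u, v). u < k \<and> v < k \<and> u \<noteq> v}"
      by (rule finite_subset[of _ "{..<k} \<times> {..<k}"]) auto
    then show ?thesis
      by unfold_locales (auto simp: complete_graph_def symmetric_def sym_def)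
  qed
  have empty: "pair_graph (empty_graph k)" for k
    by unfold_locales (auto simp: empty_graph_def symmetric_def sym_def)
  have fin: "finite (new_verts k G)" for k G
    by (simp add: new_verts_def Let_def)
  have new: "v \<notin> new_verts k G" if "pair_graph G" "v \<in> pverts G" for v k G
  proof -
    interpret pair_graph G by fact
    have "\<forall>v \<in> pverts G. v < Suc (Max (pverts G))"
      using pair_finite_verts by (simp add: less_Suc_eq_le)
    then have "\<forall>v \<in> pverts G. v < (LEAST n. \<forall>v \<in> pverts G. v < n)"
      by (rule LeastI)
    with that show ?thesis by (force simp: new_verts_def Let_def)
  qed
  have dom: "pair_graph (add_dominating k G)" if "pair_graph G" for k G
  proof -
    interpret pair_graph G by fact
    let ?W = "new_verts k G"
    have "finite {(u, v). u \<in> ?W \<and> v \<in> ?W \<and> u \<noteq> v}"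
      by (rule finite_subset[of _ "?W \<times> ?W"]) (auto simp: fin)
    moreover have "sym (parcs G)" using pair_sym_arcs by (simp add: symmetric_def)
    ultimately show ?thesis
      using pair_finite_verts pair_finite_arcs pair_no_loops new[OF that]
      by unfold_locales
        (auto simp: add_dominating_def Let_def symmetric_def sym_def fin
              dest: in_arcsD1 in_arcsD2)
  qed
  have iso: "pair_graph (add_isolated k G)" if "pair_graph G" for k G
  proof -
    interpret pair_graph G by fact
    have "sym (parcs G)" using pair_sym_arcs by (simp add: symmetric_def)
    then show ?thesis
      using pair_finite_verts pair_finite_arcs pair_no_loops
      by unfold_locales
        (auto simp: add_isolated_def symmetric_def fin dest: in_arcsD1 in_arcsD2)
  qed
  have "pair_graph (threshold_stage r a i)" for i
  proof (induction r a i rule: threshold_stage.induct)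
    case (1 r a i)
    then show ?case
      by (subst threshold_stage.simps) (auto simp: complete empty dom iso)
  qed
  then show ?thesis by (simp add: threshold_graph_def)
qed

end

theory Submission
  imports Defs
begin

text \<open>
  Let \<open>0 < x \<le> N\<close>. On the vertices of \<open>G\<^sub>i\<close> an eigenvector \<open>w\<close> of \<open>G\<^sub>1\<close> for \<open>x\<close> satisfies
  \<open>A(G\<^sub>i) w + c \<cdot> 1 = x w\<close>, where the load \<open>c\<close> is the total weight of the dominating vertices
  added later. This forces \<open>c = - s\<^sub>i \<Sum>w\<close> with a ratio \<open>s\<^sub>i\<close> depending only on \<open>G\<^sub>i\<close> and \<open>x\<close>: it is
  \<open>1 - (x + 1)/a\<close> for \<open>K\<^sub>a\<close> and \<open>- x/a\<close> for its complement, while disjoint unions combine the ratios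
  by \<open>g\<close> and joins by \<open>f\<close>. Both \<open>f\<close> and \<open>g\<close> are monotone where they are used, and \<open>N\<close> is chosen such
  that \<open>g(1 - \<surd>2/2, - N) = - \<surd>2/2\<close> and \<open>f(- \<surd>2/2, - N) = 1 - \<surd>2/2\<close>. Hence \<open>s\<^sub>i \<ge> 1 - \<surd>2/2\<close> for odd
  \<open>i\<close> and \<open>- \<surd>2/2 \<le> s\<^sub>i < 0\<close> for even \<open>i\<close>, whatever the parameters. As no \<open>s\<^sub>i\<close> vanishes, a vector
  with load \<open>c = 0\<close> is zero.
\<close>

section \<open>Adjacency eigenvalues as weightings of the vertices\<close>

definition neighbour_sum :: "'v pair_pre_digraph \<Rightarrow> ('v \<Rightarrow> real) \<Rightarrow> 'v \<Rightarrow> real" where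
  "neighbour_sum G w u = sum w (parcs G `` {u})"

definition vertex_vec :: "'v::linorder pair_pre_digraph \<Rightarrow> ('v \<Rightarrow> real) \<Rightarrow> real vec" where
  "vertex_vec G w = vec (card (pverts G)) (\<lambda>i. w (sorted_list_of_set (pverts G) ! i))"

lemma bij_betw_sorted_list_of_set:
  assumes "finite A"
  shows "bij_betw ((!) (sorted_list_of_set A)) {..<card A} A"
  using assms by (intro bij_betw_nth) auto

lemma vertex_vec_eq_iff:
  assumes "finite (pverts G)"
  shows "vertex_vec G w = vertex_vec G w' \<longleftrightarrow> (\<forall>u \<in> pverts G. w u = w' u)"
proof -
  have "(\<forall>i<card (pverts G). w (sorted_list_of_set (pverts G) ! i)
      = w' (sorted_list_of_set (pverts G) ! i)) \<longleftrightarrow> (\<forall>u \<in> pverts G. w u = w' u)"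
    using bij_betw_imp_surj_on[OF bij_betw_sorted_list_of_set[OF assms]] by force
  then show ?thesis by (auto simp: vertex_vec_def vec_eq_iff)
qed

lemma vertex_vec_cases:
  assumes "finite (pverts G)" "v \<in> carrier_vec (card (pverts G))"
  obtains w where "v = vertex_vec G w"
proof
  define f where "f = (!) (sorted_list_of_set (pverts G))"
  have "inj_on f {..<card (pverts G)}"
    using bij_betw_sorted_list_of_set[OF assms(1)] by (simp add: f_def bij_betw_def)
  then show "v = vertex_vec G (\<lambda>u. v $ the_inv_into {..<card (pverts G)} f u)"
    using assms(2) by (auto simp: vertex_vec_def vec_eq_iff the_inv_into_f_f simp flip: f_def)
qed

lemma adjacency_matrix_mult_vertex_vec:
  assumes "pair_fin_digraph G"
  shows "adjacency_matrix G *\<^sub>v vertex_vec G w = vertex_vec G (neighbour_sum G w)"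
proof (rule eq_vecI)
  interpret pair_fin_digraph G by fact
  define f where "f = (!) (sorted_list_of_set (pverts G))"
  let ?n = "card (pverts G)"
  fix i assume "i < dim_vec (vertex_vec G (neighbour_sum G w))"
  then have i: "i < ?n" by (simp add: vertex_vec_def)
  have "(adjacency_matrix G *\<^sub>v vertex_vec G w) $ i =
      (\<Sum>j<?n. (if (f i, f j) \<in> parcs G then 1 else 0) * w (f j))"
    using i by (simp add: adjacency_matrix_def vertex_vec_def f_def scalar_prod_def
        lessThan_atLeast0 Let_def)
  also have "\<dots> = (\<Sum>v \<in> pverts G. (if (f i, v) \<in> parcs G then 1 else 0) * w v)"
    using bij_betw_sorted_list_of_set[OF pair_finite_verts]
    by (intro sum.reindex_bij_betw) (simp add: f_def)
  also have "\<dots> = neighbour_sum G w (f i)"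
    unfolding neighbour_sum_def using pair_finite_verts
    by (intro sum.mono_neutral_cong_right) (auto dest: in_arcsD2)
  finally show "(adjacency_matrix G *\<^sub>v vertex_vec G w) $ i = vertex_vec G (neighbour_sum G w) $ i"
    using i by (simp add: vertex_vec_def f_def)
qed (simp add: adjacency_matrix_def vertex_vec_def Let_def)

lemma eigenvalue_adjacency_matrix_iff:
  assumes "pair_fin_digraph G"
  shows "eigenvalue (adjacency_matrix G) x \<longleftrightarrow>
    (\<exists>w. (\<forall>u \<in> pverts G. neighbour_sum G w u = x * w u) \<and> (\<exists>u \<in> pverts G. w u \<noteq> 0))"
proof -
  interpret pair_fin_digraph G by fact
  let ?A = "adjacency_matrix G" and ?n = "card (pverts G)"
  have vertex_vec: "eigenvector ?A (vertex_vec G w) x \<longleftrightarrow>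
      (\<forall>u \<in> pverts G. neighbour_sum G w u = x * w u) \<and> (\<exists>u \<in> pverts G. w u \<noteq> 0)" for w
  proof -
    have "dim_row ?A = ?n" by (simp add: adjacency_matrix_def Let_def)
    moreover have "0\<^sub>v ?n = vertex_vec G (\<lambda>_. 0)" "x \<cdot>\<^sub>v vertex_vec G w = vertex_vec G (\<lambda>u. x * w u)"
      by (auto simp: vertex_vec_def)
    moreover have "vertex_vec G w \<in> carrier_vec ?n" by (simp add: vertex_vec_def)
    ultimately show ?thesis
      by (auto simp: eigenvector_def adjacency_matrix_mult_vertex_vec[OF assms]
          vertex_vec_eq_iff[OF pair_finite_verts])
  qed
  have "\<exists>w. v = vertex_vec G w" if "eigenvector ?A v x" for v
  proof -
    have "v \<in> carrier_vec ?n"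
      using that by (simp add: eigenvector_def adjacency_matrix_def Let_def)
    then show ?thesis by (rule vertex_vec_cases[OF pair_finite_verts]) (rule exI)
  qed
  then have "eigenvalue ?A x \<longleftrightarrow> (\<exists>w. eigenvector ?A (vertex_vec G w) x)"
    unfolding eigenvalue_def by blast
  then show ?thesis by (simp only: vertex_vec)
qed

section \<open>Unions, joins and load ratios\<close>

definition edgeless :: "'v set \<Rightarrow> 'v pair_pre_digraph" where
  "edgeless W = \<lparr> pverts = W, parcs = {} \<rparr>"

definition clique :: "'v set \<Rightarrow> 'v pair_pre_digraph" where
  "clique W = \<lparr> pverts = W, parcs = {(u, v). u \<in> W \<and> v \<in> W \<and> u \<noteq> v} \<rparr>"

definition graph_union ::
    "'v pair_pre_digraph \<Rightarrow> 'v pair_pre_digraph \<Rightarrow> 'v pair_pre_digraph" where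
  "graph_union G H = \<lparr> pverts = pverts G \<union> pverts H, parcs = parcs G \<union> parcs H \<rparr>"

definition graph_join ::
    "'v pair_pre_digraph \<Rightarrow> 'v pair_pre_digraph \<Rightarrow> 'v pair_pre_digraph" where
  "graph_join G H = \<lparr> pverts = pverts G \<union> pverts H,
     parcs = parcs G \<union> parcs H \<union> pverts G \<times> pverts H \<union> pverts H \<times> pverts G \<rparr>"

lemma pverts_simps [simp]:
  "pverts (edgeless W) = W" "pverts (clique W) = W"
  "pverts (graph_union G H) = pverts G \<union> pverts H"
  "pverts (graph_join G H) = pverts G \<union> pverts H"
  by (simp_all add: edgeless_def clique_def graph_union_def graph_join_def)

lemma graph_union_commute: "graph_union G H = graph_union H G"
  by (simp add: graph_union_def Un_commute)

lemma graph_join_commute: "graph_join G H = graph_join H G"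
  by (auto simp: graph_join_def)

lemma pair_fin_digraph_edgeless: "finite W \<Longrightarrow> pair_fin_digraph (edgeless W)"
  by unfold_locales (auto simp: edgeless_def)

lemma pair_fin_digraph_clique:
  assumes "finite W"
  shows "pair_fin_digraph (clique W)"
proof -
  have "finite {(u, v). u \<in> W \<and> v \<in> W \<and> u \<noteq> v}"
    by (rule finite_subset[of _ "W \<times> W"]) (auto simp: assms)
  then show ?thesis using assms by unfold_locales (auto simp: clique_def)
qed

lemma pair_fin_digraph_graph_union:
  assumes "pair_fin_digraph G" "pair_fin_digraph H"
  shows "pair_fin_digraph (graph_union G H)"
proof -
  interpret G: pair_fin_digraph G by fact
  interpret H: pair_fin_digraph H by fact
  show ?thesis
    using G.pair_finite_verts G.pair_finite_arcs H.pair_finite_verts H.pair_finite_arcs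
    by unfold_locales (auto simp: graph_union_def dest: G.wellformed' H.wellformed')
qed

lemma pair_fin_digraph_graph_join:
  assumes "pair_fin_digraph G" "pair_fin_digraph H"
  shows "pair_fin_digraph (graph_join G H)"
proof -
  interpret G: pair_fin_digraph G by fact
  interpret H: pair_fin_digraph H by fact
  show ?thesis
    using G.pair_finite_verts G.pair_finite_arcs H.pair_finite_verts H.pair_finite_arcs
    by unfold_locales (auto simp: graph_join_def dest: G.wellformed' H.wellformed')
qed

lemma neighbour_sum_edgeless: "neighbour_sum (edgeless W) w u = 0"
  by (simp add: neighbour_sum_def edgeless_def)

lemma neighbour_sum_clique:
  assumes "finite W" "u \<in> W"
  shows "neighbour_sum (clique W) w u = sum w W - w u"
proof -
  have "parcs (clique W) `` {u} = W - {u}" using assms by (auto simp: clique_def)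
  then show ?thesis using assms by (simp add: neighbour_sum_def sum_diff1)
qed

lemma neighbour_sum_graph_union:
  assumes "pair_wf_digraph H" "pverts G \<inter> pverts H = {}" "u \<in> pverts G"
  shows "neighbour_sum (graph_union G H) w u = neighbour_sum G w u"
proof -
  interpret H: pair_wf_digraph H by fact
  have "parcs (graph_union G H) `` {u} = parcs G `` {u}"
    using assms(2,3) by (auto simp: graph_union_def dest: H.wellformed')
  then show ?thesis by (simp add: neighbour_sum_def)
qed

lemma neighbour_sum_graph_join:
  assumes "pair_fin_digraph G" "pair_fin_digraph H" "pverts G \<inter> pverts H = {}" "u \<in> pverts G"
  shows "neighbour_sum (graph_join G H) w u = neighbour_sum G w u + sum w (pverts H)"
proof -
  interpret G: pair_fin_digraph G by fact
  interpret H: pair_fin_digraph H by fact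
  have nbhd: "parcs G `` {u} \<subseteq> pverts G" by (auto dest: G.wellformed')
  have "parcs (graph_join G H) `` {u} = parcs G `` {u} \<union> pverts H"
    using assms(3,4) by (auto simp: graph_join_def dest: H.wellformed')
  moreover have "parcs G `` {u} \<inter> pverts H = {}" using nbhd assms(3) by blast
  moreover have "finite (parcs G `` {u})" using nbhd G.pair_finite_verts by (rule finite_subset)
  ultimately show ?thesis
    using H.pair_finite_verts by (simp add: neighbour_sum_def sum.union_disjoint)
qed

definition loaded_eigenvector ::
    "'v pair_pre_digraph \<Rightarrow> real \<Rightarrow> real \<Rightarrow> ('v \<Rightarrow> real) \<Rightarrow> bool" where
  "loaded_eigenvector G x c w \<longleftrightarrow> (\<forall>u \<in> pverts G. neighbour_sum G w u + c = x * w u)"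

lemma loaded_eigenvector_edgeless:
  "loaded_eigenvector (edgeless W) x c w \<longleftrightarrow> (\<forall>u \<in> W. c = x * w u)"
  by (simp add: loaded_eigenvector_def neighbour_sum_edgeless)

lemma loaded_eigenvector_clique:
  assumes "finite W"
  shows "loaded_eigenvector (clique W) x c w \<longleftrightarrow> (\<forall>u \<in> W. sum w W + c = (x + 1) * w u)"
  using assms by (auto simp: loaded_eigenvector_def neighbour_sum_clique algebra_simps)

lemma loaded_eigenvector_graph_union:
  assumes "pair_wf_digraph G" "pair_wf_digraph H" "pverts G \<inter> pverts H = {}"
  shows "loaded_eigenvector (graph_union G H) x c w \<longleftrightarrow>
    loaded_eigenvector G x c w \<and> loaded_eigenvector H x c w"
proof -
  have "neighbour_sum (graph_union G H) w u = neighbour_sum G w u" if "u \<in> pverts G" for u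
    using assms that by (intro neighbour_sum_graph_union)
  moreover have "neighbour_sum (graph_union G H) w u = neighbour_sum H w u" if "u \<in> pverts H" for u
    using assms that by (subst graph_union_commute, intro neighbour_sum_graph_union) auto
  ultimately show ?thesis by (simp add: loaded_eigenvector_def ball_Un)
qed

lemma loaded_eigenvector_graph_join:
  assumes "pair_fin_digraph G" "pair_fin_digraph H" "pverts G \<inter> pverts H = {}"
  shows "loaded_eigenvector (graph_join G H) x c w \<longleftrightarrow>
    loaded_eigenvector G x (c + sum w (pverts H)) w \<and>
    loaded_eigenvector H x (c + sum w (pverts G)) w"
proof -
  have "neighbour_sum (graph_join G H) w u = neighbour_sum G w u + sum w (pverts H)"
    if "u \<in> pverts G" for u
    using assms that by (intro neighbour_sum_graph_join)
  moreover have "neighbour_sum (graph_join G H) w u = neighbour_sum H w u + sum w (pverts G)"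
    if "u \<in> pverts H" for u
    using assms that by (subst graph_join_commute, intro neighbour_sum_graph_join) auto
  ultimately show ?thesis by (simp add: loaded_eigenvector_def ball_Un ac_simps)
qed

text \<open>
  The ratio \<open>s\<close> is \<open>-1 / (1\<^sup>T (x I - A)\<^sup>-\<^sup>1 1)\<close>, the negative reciprocal of the coronal of \<open>G\<close> at \<open>x\<close>.
\<close>

definition load_ratio :: "'v pair_pre_digraph \<Rightarrow> real \<Rightarrow> real \<Rightarrow> bool" where
  "load_ratio G x s \<longleftrightarrow> (\<forall>c w. loaded_eigenvector G x c w \<longrightarrow>
     c = - s * sum w (pverts G) \<and> (c = 0 \<longrightarrow> (\<forall>u \<in> pverts G. w u = 0)))"

lemma load_ratioI:
  assumes "\<And>c w. loaded_eigenvector G x c w \<Longrightarrow> c = - s * sum w (pverts G)"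
    and "\<And>w u. loaded_eigenvector G x 0 w \<Longrightarrow> u \<in> pverts G \<Longrightarrow> w u = 0"
  shows "load_ratio G x s"
  using assms unfolding load_ratio_def by blast

lemma load_ratioD:
  assumes "load_ratio G x s"
  shows "loaded_eigenvector G x c w \<Longrightarrow> c = - s * sum w (pverts G)"
    and "loaded_eigenvector G x 0 w \<Longrightarrow> u \<in> pverts G \<Longrightarrow> w u = 0"
  using assms unfolding load_ratio_def by blast+

lemma load_ratio_not_eigenvalue:
  assumes "pair_fin_digraph G" "load_ratio G x s"
  shows "\<not> eigenvalue (adjacency_matrix G) x"
  using load_ratioD(2)[OF assms(2)]
  by (auto simp: eigenvalue_adjacency_matrix_iff[OF assms(1)] loaded_eigenvector_def)

lemma load_ratio_edgeless:
  assumes "finite W" "W \<noteq> {}" "x \<noteq> 0"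
  shows "load_ratio (edgeless W) x (- (x / real (card W)))"
proof (rule load_ratioI)
  fix c w assume "loaded_eigenvector (edgeless W) x c w"
  then have "x * w u = c" if "u \<in> W" for u
    using that by (auto simp: loaded_eigenvector_edgeless)
  then have "x * sum w W = real (card W) * c" by (simp add: sum_distrib_left)
  then show "c = - (- (x / real (card W))) * sum w (pverts (edgeless W))"
    using assms by (simp add: field_simps)
qed (use assms in \<open>simp add: loaded_eigenvector_edgeless\<close>)

lemma load_ratio_clique:
  assumes "finite W" "W \<noteq> {}" "x + 1 \<noteq> 0" "x + 1 \<noteq> real (card W)"
  shows "load_ratio (clique W) x (1 - (x + 1) / real (card W))"
proof (rule load_ratioI)
  have total: "(x + 1) * sum w W = real (card W) * (sum w W + c)"
    if "loaded_eigenvector (clique W) x c w" for c w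
  proof -
    have "(x + 1) * w u = sum w W + c" if "u \<in> W" for u
      using \<open>loaded_eigenvector (clique W) x c w\<close> that
      by (auto simp: loaded_eigenvector_clique[OF assms(1)])
    then show ?thesis by (simp add: sum_distrib_left)
  qed
  show "c = - (1 - (x + 1) / real (card W)) * sum w (pverts (clique W))"
    if "loaded_eigenvector (clique W) x c w" for c w
    using total[OF that] assms by (simp add: field_simps)
  show "w u = 0" if "loaded_eigenvector (clique W) x 0 w" "u \<in> pverts (clique W)" for w u
  proof -
    have "sum w W = 0" using total[OF that(1)] assms(4) by simp
    then show ?thesis using that assms(1,3) by (simp add: loaded_eigenvector_clique)
  qed
qed

lemma load_ratio_graph_union:
  assumes G: "pair_fin_digraph G" "load_ratio G x s" and H: "pair_fin_digraph H" "load_ratio H x t"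
    and disjoint: "pverts G \<inter> pverts H = {}" and "s + t \<noteq> 0"
  shows "load_ratio (graph_union G H) x (g_step s t)"
proof (rule load_ratioI)
  interpret G: pair_fin_digraph G by fact
  interpret H: pair_fin_digraph H by fact
  note loaded_iff =
    loaded_eigenvector_graph_union[OF G.pair_wf_digraph_axioms H.pair_wf_digraph_axioms disjoint]
  show "c = - g_step s t * sum w (pverts (graph_union G H))"
    if "loaded_eigenvector (graph_union G H) x c w" for c w
  proof -
    let ?S = "sum w (pverts G)" and ?T = "sum w (pverts H)"
    have loads: "c = - s * ?S" "c = - t * ?T"
      using that load_ratioD(1)[OF G(2)] load_ratioD(1)[OF H(2)] by (simp_all add: loaded_iff)
    have "(s + t) * c = s * (- t * ?T) + t * (- s * ?S)"
      unfolding distrib_right using loads by metis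
    then have "c = - (s * t) * (?S + ?T) / (s + t)"
      using \<open>s + t \<noteq> 0\<close> by (simp add: eq_divide_eq algebra_simps)
    moreover have "sum w (pverts (graph_union G H)) = ?S + ?T"
      using disjoint G.pair_finite_verts H.pair_finite_verts by (simp add: sum.union_disjoint)
    ultimately show ?thesis by (simp add: g_step_def)
  qed
  show "w u = 0" if "loaded_eigenvector (graph_union G H) x 0 w"
    and "u \<in> pverts (graph_union G H)" for w u
    using that load_ratioD(2)[OF G(2)] load_ratioD(2)[OF H(2)] by (auto simp: loaded_iff)
qed

lemma load_ratio_graph_join:
  assumes G: "pair_fin_digraph G" "load_ratio G x s" and H: "pair_fin_digraph H" "load_ratio H x t"
    and disjoint: "pverts G \<inter> pverts H = {}" and "s + t \<noteq> 2" "s * t \<noteq> 1"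
  shows "load_ratio (graph_join G H) x (f_step s t)"
proof (rule load_ratioI)
  interpret G: pair_fin_digraph G by fact
  interpret H: pair_fin_digraph H by fact
  note loaded_iff = loaded_eigenvector_graph_join[OF G(1) H(1) disjoint]
  have loads: "c + sum w (pverts H) = - s * sum w (pverts G)"
      "c + sum w (pverts G) = - t * sum w (pverts H)"
    if "loaded_eigenvector (graph_join G H) x c w" for c w
    using that load_ratioD(1)[OF G(2)] load_ratioD(1)[OF H(2)] by (simp_all add: loaded_iff)
  show "c = - f_step s t * sum w (pverts (graph_join G H))"
    if "loaded_eigenvector (graph_join G H) x c w" for c w
  proof -
    let ?S = "sum w (pverts G)" and ?T = "sum w (pverts H)"
    have "(s + t - 2) * c + (s * t - 1) * (?S + ?T) =
        (t - 1) * (c + ?T + s * ?S) + (s - 1) * (c + ?S + t * ?T)"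
      by (simp add: algebra_simps)
    also have "\<dots> = 0" using loads[OF that] by simp
    finally have "c * (s + t - 2) = - (s * t - 1) * (?S + ?T)" by (simp add: algebra_simps)
    then have "c = - (s * t - 1) * (?S + ?T) / (s + t - 2)"
      using \<open>s + t \<noteq> 2\<close> by (simp add: eq_divide_eq)
    moreover have "sum w (pverts (graph_join G H)) = ?S + ?T"
      using disjoint G.pair_finite_verts H.pair_finite_verts by (simp add: sum.union_disjoint)
    ultimately show ?thesis by (simp add: f_step_def minus_divide_left del: divide_minus_left)
  qed
  show "w u = 0" if w: "loaded_eigenvector (graph_join G H) x 0 w"
    and u: "u \<in> pverts (graph_join G H)" for w u
  proof -
    let ?S = "sum w (pverts G)" and ?T = "sum w (pverts H)"
    have "(1 - s * t) * ?S = (?S + t * ?T) - t * (?T + s * ?S)" by (simp add: algebra_simps)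
    also have "\<dots> = 0" using loads[OF w] by simp
    finally have "?S = 0" using \<open>s * t \<noteq> 1\<close> by simp
    moreover have "?T = 0" using loads(1)[OF w] \<open>?S = 0\<close> by simp
    ultimately have "loaded_eigenvector G x 0 w" "loaded_eigenvector H x 0 w"
      using w by (simp_all add: loaded_iff)
    then show ?thesis using u load_ratioD(2)[OF G(2)] load_ratioD(2)[OF H(2)] by auto
  qed
qed

section \<open>The recursion for the ratios\<close>

lemma g_step_commute: "g_step X Y = g_step Y X"
  by (simp add: g_step_def ac_simps)

lemma g_step_mono:
  assumes "0 < X + Y" "X \<le> X'" "Y \<le> Y'"
  shows "g_step X Y \<le> g_step X' Y'"
proof -
  have mono_left: "g_step X Y \<le> g_step X' Y" if "0 < X + Y" "X \<le> X'" for X X' Y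
  proof -
    have "g_step X' Y - g_step X Y = Y\<^sup>2 * (X' - X) / ((X' + Y) * (X + Y))"
      using that by (simp add: g_step_def field_simps power2_eq_square)
    moreover have "\<dots> \<ge> 0" using that by simp
    ultimately show ?thesis by linarith
  qed
  have "g_step X Y \<le> g_step X' Y" using assms by (intro mono_left)
  also have "\<dots> \<le> g_step X' Y'"
    using assms mono_left[of Y X' Y'] by (simp add: g_step_commute add.commute)
  finally show ?thesis .
qed

lemma f_step_eq_g_step:
  assumes "X + Y \<noteq> 2"
  shows "f_step X Y = 1 - g_step (1 - X) (1 - Y)"
  using assms by (simp add: f_step_def g_step_def field_simps)

lemma f_step_mono:
  assumes "X' + Y' < 2" "X \<le> X'" "Y \<le> Y'"
  shows "f_step X Y \<le> f_step X' Y'"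
  using assms g_step_mono[of "1 - X'" "1 - Y'" "1 - X" "1 - Y"] by (simp add: f_step_eq_g_step)

definition threshold_gap :: real where
  "threshold_gap = (- 1 + sqrt 2) / 2"

lemma sqrt_2_bounds: "14 / 10 < sqrt 2" "sqrt 2 < 15 / 10"
  by (rule real_less_rsqrt, simp add: power2_eq_square)
    (rule real_less_lsqrt, simp_all add: power2_eq_square)

lemma threshold_gap_bounds: "2 / 10 < threshold_gap" "threshold_gap < 25 / 100"
  using sqrt_2_bounds by (simp_all add: threshold_gap_def)

lemma g_step_threshold_gap: "g_step (1 - sqrt 2 / 2) (- threshold_gap) = - (sqrt 2 / 2)"
  using sqrt_2_bounds by (simp add: g_step_def threshold_gap_def field_simps)

lemma f_step_threshold_gap: "f_step (- (sqrt 2 / 2)) (- threshold_gap) = 1 - sqrt 2 / 2"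
  using sqrt_2_bounds by (simp add: f_step_def threshold_gap_def field_simps)

definition block_ratio :: "real \<Rightarrow> nat \<Rightarrow> nat \<Rightarrow> real" where
  "block_ratio x i k = (if odd i then 1 - (x + 1) / real k else - (x / real k))"

definition attach_ratio :: "nat \<Rightarrow> real \<Rightarrow> real \<Rightarrow> real" where
  "attach_ratio i s t = (if odd i then f_step s t else g_step s t)"

function stage_ratio :: "real \<Rightarrow> nat \<Rightarrow> (nat \<Rightarrow> nat) \<Rightarrow> nat \<Rightarrow> real" where
  "stage_ratio x r a i =
    (if r \<le> i then block_ratio x r (a r)
     else attach_ratio i (stage_ratio x r a (Suc i)) (block_ratio x i (a i)))"
  by auto
termination by (relation "measure (\<lambda>(x, r, a, i). r - i)") auto

declare stage_ratio.simps [simp del]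

lemma stage_ratio_last: "stage_ratio x r a r = block_ratio x r (a r)"
  by (simp add: stage_ratio.simps)

lemma stage_ratio_attach:
  "i < r \<Longrightarrow>
    stage_ratio x r a i = attach_ratio i (stage_ratio x r a (Suc i)) (block_ratio x i (a i))"
  by (simp add: stage_ratio.simps[of x r a i])

definition ratio_range :: "nat \<Rightarrow> real set" where
  "ratio_range i = (if odd i then {1 - sqrt 2 / 2..} else {- (sqrt 2 / 2)..<0})"

lemma block_ratio_bounds:
  assumes "0 < x" "x \<le> threshold_gap" "1 \<le> k"
  shows "- threshold_gap \<le> block_ratio x i k" "block_ratio x i k < (if odd i then 1 else 0)"
proof -
  have "x / real k \<le> x / 1" "(x + 1) / real k \<le> (x + 1) / 1"
    using assms by (intro divide_left_mono; simp)+
  then show "- threshold_gap \<le> block_ratio x i k" "block_ratio x i k < (if odd i then 1 else 0)"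
    using assms by (auto simp: block_ratio_def)
qed

lemma block_ratio_in_range:
  assumes "0 < x" "x \<le> threshold_gap" "2 \<le> k"
  shows "block_ratio x i k \<in> ratio_range i"
proof -
  have "(x + 1) / real k \<le> (x + 1) / 2" using assms by (intro divide_left_mono) auto
  also have "\<dots> \<le> sqrt 2 / 2"
    using assms(2) sqrt_2_bounds by (simp add: threshold_gap_def)
  finally show ?thesis
    using assms block_ratio_bounds[of x k i] threshold_gap_bounds sqrt_2_bounds
    by (auto simp: ratio_range_def block_ratio_def)
qed

lemma attach_ratio_in_range:
  assumes s: "s \<in> ratio_range (Suc i)"
    and t: "- threshold_gap \<le> t" "t < (if odd i then 1 else 0)"
  shows "attach_ratio i s t \<in> ratio_range i"
proof (cases "odd i")
  case True
  then have "1 - sqrt 2 / 2 \<le> f_step s t"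
    using s t unfolding f_step_threshold_gap[symmetric]
    by (intro f_step_mono) (auto simp: ratio_range_def)
  then show ?thesis using True by (simp add: attach_ratio_def ratio_range_def)
next
  case False
  have pos: "0 < 1 - sqrt 2 / 2 + - threshold_gap"
    using threshold_gap_bounds sqrt_2_bounds by simp
  have s_ge: "1 - sqrt 2 / 2 \<le> s" using s False by (simp add: ratio_range_def)
  have "- (sqrt 2 / 2) \<le> g_step s t"
    unfolding g_step_threshold_gap[symmetric] using pos s_ge t by (intro g_step_mono)
  moreover have "g_step s t < 0"
    using pos s_ge t False threshold_gap_bounds
    by (auto simp: g_step_def intro!: divide_neg_pos mult_pos_neg)
  ultimately show ?thesis using False by (simp add: attach_ratio_def ratio_range_def)
qed

lemma stage_ratio_in_range:
  assumes "0 < x" "x \<le> threshold_gap" "2 \<le> a r" "\<And>j. j \<in> {i..<r} \<Longrightarrow> 1 \<le> a j" "i \<le> r"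
  shows "stage_ratio x r a i \<in> ratio_range i"
  using assms(5,4)
proof (induction i rule: inc_induct)
  case base
  show ?case
    using block_ratio_in_range[OF assms(1-3)] by (simp add: stage_ratio_last)
next
  case (step i)
  then have "stage_ratio x r a (Suc i) \<in> ratio_range (Suc i)" "1 \<le> a i" by auto
  then show ?case
    using step.hyps block_ratio_bounds[OF assms(1,2)]
    by (simp add: stage_ratio_attach attach_ratio_in_range)
qed

section \<open>Threshold graphs\<close>

definition block_graph :: "nat \<Rightarrow> 'v set \<Rightarrow> 'v pair_pre_digraph" where
  "block_graph i W = (if odd i then clique W else edgeless W)"

definition attach_graph ::
    "nat \<Rightarrow> 'v pair_pre_digraph \<Rightarrow> 'v pair_pre_digraph \<Rightarrow> 'v pair_pre_digraph" where
  "attach_graph i G H = (if odd i then graph_join G H else graph_union G H)"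

lemma pverts_block_graph [simp]: "pverts (block_graph i W) = W"
  by (simp add: block_graph_def)

lemma pair_fin_digraph_block_graph: "finite W \<Longrightarrow> pair_fin_digraph (block_graph i W)"
  by (simp add: block_graph_def pair_fin_digraph_clique pair_fin_digraph_edgeless)

lemma pair_fin_digraph_attach_graph:
  "pair_fin_digraph G \<Longrightarrow> pair_fin_digraph H \<Longrightarrow> pair_fin_digraph (attach_graph i G H)"
  by (simp add: attach_graph_def pair_fin_digraph_graph_join pair_fin_digraph_graph_union)

lemma new_verts_fresh:
  assumes "finite (pverts G)"
  shows "pverts G \<inter> new_verts k G = {}"
proof -
  have "\<forall>v \<in> pverts G. v < Suc (Max (pverts G))"
    using assms by (simp add: less_Suc_eq_le)
  then have "\<forall>v \<in> pverts G. v < (LEAST n. \<forall>v \<in> pverts G. v < n)"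
    by (rule LeastI)
  then show ?thesis by (force simp: new_verts_def Let_def)
qed

lemma finite_new_verts [simp]: "finite (new_verts k G)"
  and card_new_verts [simp]: "card (new_verts k G) = k"
  by (simp_all add: new_verts_def Let_def)

lemma threshold_stage_last: "threshold_stage r a r = block_graph r {..<a r}"
  by (subst threshold_stage.simps)
    (simp add: block_graph_def complete_graph_def clique_def empty_graph_def edgeless_def)

lemma threshold_stage_attach:
  assumes "i < r"
  shows "threshold_stage r a i = (let G = threshold_stage r a (Suc i)
    in attach_graph i G (block_graph i (new_verts (a i) G)))"
  using assms
  by (subst threshold_stage.simps)
    (auto simp: attach_graph_def block_graph_def add_dominating_def add_isolated_def
      graph_join_def graph_union_def clique_def edgeless_def Let_def)

lemma pair_fin_digraph_threshold_stage:
  assumes "i \<le> r"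
  shows "pair_fin_digraph (threshold_stage r a i)"
  using assms
proof (induction i rule: inc_induct)
  case base
  show ?case by (simp add: threshold_stage_last pair_fin_digraph_block_graph)
next
  case (step i)
  then show ?case
    by (simp add: threshold_stage_attach Let_def pair_fin_digraph_attach_graph
        pair_fin_digraph_block_graph)
qed

lemma load_ratio_block_graph:
  assumes "0 < x" "x < 1" "finite W" "W \<noteq> {}"
  shows "load_ratio (block_graph i W) x (block_ratio x i (card W))"
proof -
  have "x + 1 \<noteq> real k" for k
  proof
    assume "x + 1 = real k"
    then have "1 < k" "k < 2" using assms by linarith+
    then show False by simp
  qed
  then show ?thesis
    using assms
    by (simp add: block_graph_def block_ratio_def load_ratio_clique load_ratio_edgeless)
qed

lemma load_ratio_attach_graph:
  assumes G: "pair_fin_digraph G" "load_ratio G x s" and H: "pair_fin_digraph H" "load_ratio H x t"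
    and disjoint: "pverts G \<inter> pverts H = {}"
    and nonzero: "attach_ratio i s t \<noteq> 0" \<comment> \<open>hence nonzero denominators, as \<open>y / 0 = 0\<close>\<close>
  shows "load_ratio (attach_graph i G H) x (attach_ratio i s t)"
  using load_ratio_graph_join[OF G H disjoint] load_ratio_graph_union[OF G H disjoint] nonzero
  by (cases "odd i") (auto simp: attach_graph_def attach_ratio_def f_step_def g_step_def)

lemma zero_notin_ratio_range: "0 \<notin> ratio_range i"
  using sqrt_2_bounds by (simp add: ratio_range_def)

lemma load_ratio_threshold_stage:
  assumes x: "0 < x" "x \<le> threshold_gap"
    and a: "2 \<le> a r" "\<And>j. j \<in> {i..<r} \<Longrightarrow> 1 \<le> a j" and "i \<le> r"
  shows "load_ratio (threshold_stage r a i) x (stage_ratio x r a i)"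
  using \<open>i \<le> r\<close> a(2)
proof (induction i rule: inc_induct)
  case base
  have "load_ratio (block_graph r {..<a r}) x (block_ratio x r (card {..<a r}))"
    using x a(1) threshold_gap_bounds
    by (intro load_ratio_block_graph) (auto simp: lessThan_empty_iff)
  then show ?case by (simp add: stage_ratio_last threshold_stage_last)
next
  case (step i)
  define G where "G = threshold_stage r a (Suc i)"
  define W where "W = new_verts (a i) G"
  have G: "pair_fin_digraph G"
    using step.hyps by (simp add: G_def pair_fin_digraph_threshold_stage)
  then have disjoint: "pverts G \<inter> pverts (block_graph i W) = {}"
    by (simp add: W_def new_verts_fresh pair_fin_digraph.pair_finite_verts)
  have "1 \<le> a i" using step.prems step.hyps by simp
  then have "W \<noteq> {}" using card_new_verts[of "a i" G] by (auto simp: W_def simp del: card_new_verts)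
  then have block: "load_ratio (block_graph i W) x (block_ratio x i (card W))"
    using x threshold_gap_bounds by (intro load_ratio_block_graph) (auto simp: W_def)
  have ratio: "stage_ratio x r a i =
      attach_ratio i (stage_ratio x r a (Suc i)) (block_ratio x i (card W))"
    using step.hyps by (simp add: stage_ratio_attach W_def)
  have "stage_ratio x r a i \<in> ratio_range i"
    using step.prems step.hyps by (intro stage_ratio_in_range[where r = r] x a(1)) auto
  then have "stage_ratio x r a i \<noteq> 0" using zero_notin_ratio_range by metis
  moreover have "load_ratio G x (stage_ratio x r a (Suc i))" using step by (simp add: G_def)
  ultimately have "load_ratio (attach_graph i G (block_graph i W)) x (stage_ratio x r a i)"
    unfolding ratio using G block disjoint
    by (intro load_ratio_attach_graph pair_fin_digraph_block_graph) (auto simp: W_def)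
  then show ?case using step.hyps by (simp add: threshold_stage_attach G_def W_def Let_def)
qed

lemma threshold_graph_eigenvalue_free:
  assumes "0 < r" "2 \<le> a r" "\<And>i. i \<in> {1..<r} \<Longrightarrow> 1 \<le> a i"
  shows "eigenvalue_free {0<..threshold_gap} (threshold_graph r a)"
  unfolding eigenvalue_free_def threshold_graph_def
proof
  fix x assume "x \<in> {0<..threshold_gap}"
  then have "load_ratio (threshold_stage r a 1) x (stage_ratio x r a 1)"
    using assms by (intro load_ratio_threshold_stage) auto
  then show "\<not> eigenvalue (adjacency_matrix (threshold_stage r a 1)) x"
    using assms(1) by (intro load_ratio_not_eigenvalue pair_fin_digraph_threshold_stage) auto
qed

section \<open>The greedy procedure\<close>

definition greedy_quotient :: "real \<Rightarrow> nat \<Rightarrow> real \<Rightarrow> real" where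
  "greedy_quotient N i s = (if odd i then (N + 1) / (1 - 1 / s) else N / s)"

lemma floor_greedy_quotient:
  assumes "s \<in> ratio_range (Suc i)"
  shows "\<lfloor>greedy_quotient threshold_gap i s\<rfloor> = 0"
proof (cases "odd i")
  case True
  then have "- (sqrt 2 / 2) \<le> s" "s < 0" using assms by (auto simp: ratio_range_def)
  then have "1 \<le> - (1 / s)" using sqrt_2_bounds by (simp add: field_simps)
  then show ?thesis
    using True threshold_gap_bounds by (simp add: greedy_quotient_def floor_eq_iff)
next
  case False
  then have "threshold_gap < s"
    using assms threshold_gap_bounds sqrt_2_bounds by (simp add: ratio_range_def)
  then show ?thesis
    using False threshold_gap_bounds by (simp add: greedy_quotient_def floor_eq_iff)
qed

lemma least_greedy_start: "(LEAST m. 1 + \<lfloor>threshold_gap + 1\<rfloor> \<le> m) = 2"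
proof -
  have "\<lfloor>threshold_gap + 1\<rfloor> = 1" using threshold_gap_bounds by (simp add: floor_eq_iff)
  then show ?thesis by (intro Least_equality) auto
qed

lemma greedy_runD:
  assumes "greedy_run N r a s" "i \<in> {1..<r}"
  shows "int (a i) = 1 + \<lfloor>greedy_quotient N i (s (Suc i))\<rfloor>"
    and "s i = attach_ratio i (s (Suc i)) (block_ratio N i (a i))"
  using assms
  by (auto simp: greedy_run_def greedy_quotient_def attach_ratio_def block_ratio_def)

lemma greedy_run_unique:
  assumes run: "greedy_run threshold_gap r a s" and r: "odd r" and i: "i \<in> {1..r}"
  shows "a i = (if i = r then 2 else 1) \<and> s i \<in> ratio_range i"
proof -
  have "1 \<le> i" "i \<le> r" using i by auto
  from this(2,1) show ?thesis
  proof (induction i rule: inc_induct)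
    case base
    have "a r = 2" using run unfolding greedy_run_def least_greedy_start by simp
    moreover have "s r = block_ratio threshold_gap r (a r)"
      using run r by (simp add: greedy_run_def block_ratio_def)
    ultimately show ?case using block_ratio_in_range threshold_gap_bounds by simp
  next
    case (step i)
    then have i: "i \<in> {1..<r}" and s_Suc: "s (Suc i) \<in> ratio_range (Suc i)" by auto
    have "a i = 1" using greedy_runD(1)[OF run i] floor_greedy_quotient[OF s_Suc] by simp
    moreover have "s i \<in> ratio_range i"
      unfolding greedy_runD(2)[OF run i] \<open>a i = 1\<close>
      using s_Suc threshold_gap_bounds by (intro attach_ratio_in_range block_ratio_bounds) auto
    ultimately show ?case using i by simp
  qed
qed

lemma greedy_run_stage_ratio:
  assumes r: "odd r" and params: "a r = 2" "\<And>i. i \<in> {1..<r} \<Longrightarrow> a i = 1"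
  shows "greedy_run threshold_gap r a (stage_ratio threshold_gap r a)"
proof -
  let ?N = threshold_gap and ?s = "stage_ratio threshold_gap r a"
  have range: "?s i \<in> ratio_range i" if "i \<in> {1..r}" for i
    using that threshold_gap_bounds params by (intro stage_ratio_in_range) auto
  have step: "?s i = attach_ratio i (?s (i + 1)) (block_ratio ?N i (a i))" if "i \<in> {1..<r}" for i
    using that by (simp add: stage_ratio_attach)
  have quotient: "int (a i) = 1 + \<lfloor>greedy_quotient ?N i (?s (i + 1))\<rfloor>" if "i \<in> {1..<r}" for i
    using that floor_greedy_quotient[of "?s (i + 1)" i] range[of "i + 1"] params(2) by simp
  show ?thesis
    unfolding greedy_run_def
  proof (intro conjI ballI impI)
    show "0 < a i" if "i \<in> {1..r}" for i using that params by (cases "i = r") auto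
    show "int (a r) = (LEAST m::int. 1 + \<lfloor>?N + 1\<rfloor> \<le> m)"
      unfolding least_greedy_start by (simp add: params(1))
    show "?s r = 1 - (?N + 1) / real (a r)"
      using r by (simp add: stage_ratio_last block_ratio_def)
  next
    fix i assume i: "i \<in> {1..<r}" "odd i"
    then have s_neg: "?s (i + 1) < 0" using range[of "i + 1"] by (auto simp: ratio_range_def)
    then have "1 / ?s (i + 1) < 0" by simp
    with s_neg show "?s (i + 1) \<noteq> 0" "1 - 1 / ?s (i + 1) \<noteq> 0" by auto
    show "?s (i + 1) + (1 - (?N + 1) / real (a i)) - 2 \<noteq> 0"
      using s_neg i threshold_gap_bounds by (simp add: params(2))
    show "int (a i) = 1 + \<lfloor>(?N + 1) / (1 - 1 / ?s (i + 1))\<rfloor>"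
      "?s i = f_step (?s (i + 1)) (1 - (?N + 1) / real (a i))"
      using quotient[of i] step[of i] i
      by (simp_all add: greedy_quotient_def attach_ratio_def block_ratio_def)
  next
    fix i assume i: "i \<in> {1..<r}" "even i"
    then have "1 - sqrt 2 / 2 \<le> ?s (i + 1)"
      using range[of "i + 1"] by (auto simp: ratio_range_def)
    then show "?s (i + 1) \<noteq> 0" "?s (i + 1) + - (?N / real (a i)) \<noteq> 0"
      using i threshold_gap_bounds sqrt_2_bounds by (auto simp: params(2))
    show "int (a i) = 1 + \<lfloor>?N / ?s (i + 1)\<rfloor>"
      "?s i = g_step (?s (i + 1)) (- (?N / real (a i)))"
      using quotient[of i] step[of i] i
      by (simp_all add: greedy_quotient_def attach_ratio_def block_ratio_def)
  qed
qed

theorem theorem8: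
  fixes N :: real and r :: nat
  assumes "N = (- 1 + sqrt 2) / 2" and "odd r"
  shows "(\<exists>a s. greedy_run N r a s) \<and>
    (\<forall>a s. greedy_run N r a s \<longrightarrow> a r = 2 \<and> (\<forall>i \<in> {1..<r}. a i = 1)) \<and>
    eigenvalue_free {0<..N} (threshold_graph r (\<lambda>i. if i = r then 2 else 1)) \<and>
    (\<forall>a. a r \<ge> 2 \<and> (\<forall>i \<in> {1..<r}. a i \<ge> 1) \<longrightarrow>
      eigenvalue_free {0<..N} (threshold_graph r a))"
proof -
  have N_eq: "N = threshold_gap" using assms(1) by (simp add: threshold_gap_def)
  have r_pos: "0 < r" using assms(2) by (rule odd_pos)
  have "\<exists>a s. greedy_run N r a s"
    unfolding N_eq using greedy_run_stage_ratio[of r "\<lambda>i. if i = r then 2 else 1"] assms(2)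
    by (intro exI) simp
  moreover have "a r = 2 \<and> (\<forall>i \<in> {1..<r}. a i = 1)" if "greedy_run N r a s" for a s
    using greedy_run_unique[OF that[unfolded N_eq] assms(2)] r_pos by auto
  moreover have "eigenvalue_free {0<..N} (threshold_graph r a)"
    if "2 \<le> a r" "\<forall>i \<in> {1..<r}. 1 \<le> a i" for a
    unfolding N_eq using r_pos that by (intro threshold_graph_eigenvalue_free) auto
  ultimately show ?thesis by simp
qed

end
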